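(* Let $r\ge 1$ and $n\ge r+3$ be integers, and let $S_{n,r}$ be the graph obtained from the complete graph $K_{n-r}$ by attaching $r$ pendent edges at one vertex of $K_{n-r}$. Then there exists a switching $\sigma$ of $S_{n,r}$ such that all eigenvalues of the signed graph $S_{n,r}^{\sigma}$ are main.
   Context: A signed graph $(G,\sigma)$ is a simple graph $G$ with a sign function $\sigma:E(G)\to\{+1,-1\}$; its adjacency matrix $A$ has $a_{ij}=\sigma(v_iv_j)$ if $v_i\sim v_j$ and $0$ otherwise. The eigenvalues of the signed graph are those of $A$. For $X\subseteq V(G)$, the switching of $G$ about $X$ is the signed graph $G^{\sigma}$ obtained from the all-positive graph $G$ by making negative exactly the edges between $X$ and $V(G)\setminus X$ (so $A(G^\sigma)=PA(G)P$ with $P$ diagonal, $p_{ii}=-1$ iff $v_i\in X$). An eigenvalue $\lambda$ of a signed graph is main if it has an eigenvector whose entries have nonzero sum. *)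

theory Defs
  imports "Jordan_Normal_Form.Char_Poly"
begin

text \<open>A graph on the vertex set \<open>{0..<n}\<close> is given by its edge set, a set of two-element
  subsets of \<open>{0..<n}\<close>; a sign function is a map on edges with values \<open>1\<close> and \<open>-1\<close>.\<close>

definition simple_graph :: "nat \<Rightarrow> nat set set \<Rightarrow> bool" where
  "simple_graph n E \<longleftrightarrow> (\<forall>e\<in>E. e \<subseteq> {0..<n} \<and> card e = 2)"

definition signed_graph :: "nat \<Rightarrow> nat set set \<Rightarrow> (nat set \<Rightarrow> real) \<Rightarrow> bool" where
  "signed_graph n E \<sigma> \<longleftrightarrow> simple_graph n E \<and> (\<forall>e\<in>E. \<sigma> e = 1 \<or> \<sigma> e = -1)"

definition adj_matrix :: "nat \<Rightarrow> nat set set \<Rightarrow> (nat set \<Rightarrow> real) \<Rightarrow> real mat" where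
  "adj_matrix n E \<sigma> = mat n n (\<lambda>(i, j). if {i, j} \<in> E then \<sigma> {i, j} else 0)"

definition switching :: "nat \<Rightarrow> nat set \<Rightarrow> nat set \<Rightarrow> real" where
  "switching n X e = (if \<exists>u\<in>X. \<exists>v\<in>{0..<n} - X. e = {u, v} then -1 else 1)"

definition main_eigenvalue :: "nat \<Rightarrow> nat set set \<Rightarrow> (nat set \<Rightarrow> real) \<Rightarrow> real \<Rightarrow> bool" where
  "main_eigenvalue n E \<sigma> \<mu> \<longleftrightarrow>
     (\<exists>v. eigenvector (adj_matrix n E \<sigma>) v \<mu> \<and> (\<Sum>i<n. v $ i) \<noteq> 0)"

text \<open>The clique is \<open>{0..<n - r}\<close>, and the pendent vertices \<open>n - r, \<dots>, n - 1\<close> are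
  attached to the vertex \<open>0\<close>.\<close>

definition S_edges :: "nat \<Rightarrow> nat \<Rightarrow> nat set set" where
  "S_edges n r = {{u, v} | u v. u < n - r \<and> v < n - r \<and> u \<noteq> v}
                 \<union> {{0, w} | w. n - r \<le> w \<and> w < n}"

lemma simple_graph_S_edges: "r < n \<Longrightarrow> simple_graph n (S_edges n r)"
  by (auto simp: simple_graph_def S_edges_def)

lemma signed_graph_switching: "simple_graph n E \<Longrightarrow> signed_graph n E (switching n X)"
  by (auto simp: signed_graph_def switching_def)

lemma adj_matrix_switching:
  fixes n :: nat and X :: "nat set"
  defines "P \<equiv> mat n n (\<lambda>(i, j). if i = j then (if i \<in> X then -1 else 1) else 0)"
  shows "adj_matrix n E (switching n X) = P * adj_matrix n E (\<lambda>_. 1) * P"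
proof (rule eq_matI)
  let ?p = "\<lambda>i. if i \<in> X then -1 else (1::real)"
  let ?A = "adj_matrix n E (\<lambda>_. 1)"
  fix i j assume "i < dim_row (P * ?A * P)" "j < dim_col (P * ?A * P)"
  then have ij: "i < n" "j < n" by (auto simp: P_def)
  have PA: "(P * ?A) $$ (i, k) = ?p i * ?A $$ (i, k)" if "k < n" for k
  proof -
    have "(P * ?A) $$ (i, k) = (\<Sum>l\<in>{0..<n}. (if l = i then ?p i * ?A $$ (l, k) else 0))"
    proof -
      have "(P * ?A) $$ (i, k) = (\<Sum>l\<in>{0..<n}. P $$ (i, l) * ?A $$ (l, k))"
        using ij that by (simp add: P_def adj_matrix_def scalar_prod_def)
      also have "\<dots> = (\<Sum>l\<in>{0..<n}. (if l = i then ?p i * ?A $$ (l, k) else 0))"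
        using ij by (intro sum.cong refl) (auto simp: P_def)
      finally show ?thesis .
    qed
    then show ?thesis using ij by simp
  qed
  have "(P * ?A * P) $$ (i, j) = (\<Sum>k\<in>{0..<n}. (P * ?A) $$ (i, k) * P $$ (k, j))"
    using ij by (simp add: P_def adj_matrix_def scalar_prod_def)
  also have "\<dots> = (\<Sum>k\<in>{0..<n}. (if k = j then ?p i * ?A $$ (i, k) * ?p j else 0))"
    using ij PA by (intro sum.cong refl) (auto simp: P_def)
  also have "\<dots> = ?p i * ?A $$ (i, j) * ?p j" using ij by simp
  finally have "(P * ?A * P) $$ (i, j) = ?p i * ?A $$ (i, j) * ?p j" .
  moreover have "(\<exists>u\<in>X. \<exists>v\<in>{0..<n} - X. {i, j} = {u, v}) \<longleftrightarrow> (i \<in> X) \<noteq> (j \<in> X)"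
    using ij by (fastforce simp: doubleton_eq_iff)
  ultimately show "adj_matrix n E (switching n X) $$ (i, j) = (P * ?A * P) $$ (i, j)"
    using ij by (auto simp: adj_matrix_def switching_def)
qed (auto simp: P_def adj_matrix_def)

end

theory Submission
  imports Defs
begin

text \<open>
  Conjugating with the diagonal sign matrix turns an eigenvector of the switched graph into an
  eigenvector \<open>u\<close> of \<open>S\<^sub>n\<^sub>,\<^sub>r\<close>, and the eigenvalue is main iff \<open>\<Sum>i. p\<^sub>i u\<^sub>i \<noteq> 0\<close> for some
  such \<open>u\<close>, where \<open>p\<^sub>i = -1\<close> on \<open>X\<close> and \<open>p\<^sub>i = 1\<close> elsewhere. Take \<open>X\<close> to consist of one clique
  vertex (not the centre) and \<open>q\<close> pendent vertices, and put \<open>k = n - r - 2\<close> and \<open>t = r - 2 q\<close>.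
  The eigenvalues \<open>-1\<close> and \<open>0\<close> (the latter occurs only for \<open>r \<ge> 2\<close>) have eigenvectors \<open>e\<^sub>i - e\<^sub>j\<close> supported on two clique vertices,
  respectively two pendent vertices, separated by \<open>X\<close>. Any other eigenvector is constant on
  the noncentral clique vertices and on the pendent vertices; its eigenvalue is a root of
  \<open>x\<^sup>3 - k x\<^sup>2 - (k + 1 + r) x + r k\<close>, and it is orthogonal to \<open>p\<close> only if the eigenvalue is also
  a root of \<open>x\<^sup>2 + (t - 1) x - t k\<close>. With \<open>t = -1\<close> for odd \<open>r\<close>, \<open>t = 0\<close> for \<open>r = 2\<close> and \<open>t = -2\<close>
  for even \<open>r \<ge> 4\<close>, the quadratic either has no real roots or has only the roots \<open>0\<close>, \<open>1\<close>, \<open>2\<close>,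
  of which the nonzero ones are not roots of the cubic.
\<close>

section \<open>Eigenvectors of a switching in terms of the underlying graph\<close>

definition switch_sign :: "nat set \<Rightarrow> nat \<Rightarrow> real" where
  "switch_sign X i = (if i \<in> X then -1 else 1)"

text \<open>Eigenvectors of the all-positive graph as plain functions, so that rows become finite
  sums; values at indices from \<open>n\<close> on do not matter.\<close>

definition eigenfun :: "nat \<Rightarrow> nat set set \<Rightarrow> real \<Rightarrow> (nat \<Rightarrow> real) \<Rightarrow> bool" where
  "eigenfun n E \<mu> u \<longleftrightarrow> (\<exists>i<n. u i \<noteq> 0) \<and>
     (\<forall>i<n. (\<Sum>j<n. if {i, j} \<in> E then u j else 0) = \<mu> * u i)"

lemma switch_sign_mult_cancel [simp]: "switch_sign X i * (switch_sign X i * a) = a"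
  by (simp add: switch_sign_def)

lemma switch_sign_nonzero [simp]: "switch_sign X i \<noteq> 0"
  by (simp add: switch_sign_def)

lemma switching_eq_switch_sign:
  assumes "i < n" "j < n"
  shows "switching n X {i, j} = switch_sign X i * switch_sign X j"
proof -
  have "(\<exists>u\<in>X. \<exists>v\<in>{0..<n} - X. {i, j} = {u, v}) \<longleftrightarrow> (i \<in> X) \<noteq> (j \<in> X)"
    using assms by (fastforce simp: doubleton_eq_iff)
  then show ?thesis by (auto simp: switching_def switch_sign_def)
qed

text \<open>Row \<open>i\<close> of the switched matrix carries the common factor
  \<open>switch_sign X i\<close>, which moves to the other side of the eigenvalue equation because
  it squares to 1.\<close>

lemma eigenvector_switching_iff:
  assumes v: "v \<in> carrier_vec n"
  shows "eigenvector (adj_matrix n E (switching n X)) v \<mu> \<longleftrightarrow>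
    eigenfun n E \<mu> (\<lambda>i. switch_sign X i * v $ i)"
proof -
  let ?A = "adj_matrix n E (switching n X)"
  let ?p = "switch_sign X"
  have row: "(?A *\<^sub>v v) $ i = ?p i * (\<Sum>j<n. if {i, j} \<in> E then ?p j * v $ j else 0)"
    if "i < n" for i
  proof -
    have "(?A *\<^sub>v v) $ i = (\<Sum>j<n. ?A $$ (i, j) * v $ j)"
      using that v by (simp add: adj_matrix_def scalar_prod_def lessThan_atLeast0)
    also have "\<dots> = (\<Sum>j<n. ?p i * (if {i, j} \<in> E then ?p j * v $ j else 0))"
      using that by (intro sum.cong refl) (auto simp: adj_matrix_def switching_eq_switch_sign)
    finally show ?thesis by (simp add: sum_distrib_left)
  qed
  have "?A *\<^sub>v v = \<mu> \<cdot>\<^sub>v v \<longleftrightarrow> (\<forall>i<n. (?A *\<^sub>v v) $ i = \<mu> * v $ i)"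
    using v by (auto simp: vec_eq_iff adj_matrix_def)
  also have "\<dots> \<longleftrightarrow>
    (\<forall>i<n. (\<Sum>j<n. if {i, j} \<in> E then ?p j * v $ j else 0) = \<mu> * (?p i * v $ i))"
  proof -
    have "?p i * s = \<mu> * a \<longleftrightarrow> s = \<mu> * (?p i * a)" for i s a
      by (auto simp: switch_sign_def)
    then show ?thesis by (simp add: row)
  qed
  finally have "?A *\<^sub>v v = \<mu> \<cdot>\<^sub>v v \<longleftrightarrow>
    (\<forall>i<n. (\<Sum>j<n. if {i, j} \<in> E then ?p j * v $ j else 0) = \<mu> * (?p i * v $ i))" .
  moreover have "v \<noteq> 0\<^sub>v n \<longleftrightarrow> (\<exists>i<n. ?p i * v $ i \<noteq> 0)"
    using v by (auto simp: vec_eq_iff)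
  ultimately show ?thesis
    using v by (simp add: eigenvector_def eigenfun_def adj_matrix_def)
qed

lemma eigenvalue_switchingD:
  assumes "eigenvalue (adj_matrix n E (switching n X)) \<mu>"
  obtains u where "eigenfun n E \<mu> u"
proof -
  obtain v where v: "eigenvector (adj_matrix n E (switching n X)) v \<mu>"
    using assms by (auto simp: eigenvalue_def)
  then have "v \<in> carrier_vec n" by (simp add: eigenvector_def adj_matrix_def)
  with v show ?thesis using that by (simp add: eigenvector_switching_iff)
qed

lemma main_eigenvalue_switchingI:
  assumes u: "eigenfun n E \<mu> u" and sum: "(\<Sum>i<n. switch_sign X i * u i) \<noteq> 0"
  shows "main_eigenvalue n E (switching n X) \<mu>"
proof -
  define v where "v = vec n (\<lambda>i. switch_sign X i * u i)"
  have v: "v \<in> carrier_vec n" by (simp add: v_def)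
  have "eigenfun n E \<mu> (\<lambda>i. switch_sign X i * v $ i)"
  proof -
    have "(\<Sum>j<n. if {i, j} \<in> E then switch_sign X j * v $ j else 0) =
      (\<Sum>j<n. if {i, j} \<in> E then u j else 0)" for i
      by (intro sum.cong) (auto simp: v_def)
    moreover have "switch_sign X i * v $ i = u i" if "i < n" for i
      using that by (simp add: v_def)
    ultimately show ?thesis using u by (simp add: eigenfun_def cong: conj_cong)
  qed
  moreover have "(\<Sum>i<n. v $ i) \<noteq> 0" using sum by (simp add: v_def)
  ultimately show ?thesis
    using v unfolding main_eigenvalue_def by (blast intro: eigenvector_switching_iff[THEN iffD2])
qed

section \<open>Eigenvalue equations on centre, clique and pendent vertices\<close>

lemma S_edges_iff:
  assumes "r < n" "i < n" "j < n"
  shows "{i, j} \<in> S_edges n r \<longleftrightarrow> i \<noteq> j \<and>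
    (i < n - r \<and> j < n - r \<or> i = 0 \<or> j = 0)"
proof
  assume "{i, j} \<in> S_edges n r"
  then show "i \<noteq> j \<and> (i < n - r \<and> j < n - r \<or> i = 0 \<or> j = 0)"
    using assms unfolding S_edges_def by (auto simp: doubleton_eq_iff)
next
  assume ij: "i \<noteq> j \<and> (i < n - r \<and> j < n - r \<or> i = 0 \<or> j = 0)"
  then consider "i < n - r" "j < n - r" | "i = 0" "n - r \<le> j" | "j = 0" "n - r \<le> i"
    using assms by linarith
  then show "{i, j} \<in> S_edges n r"
    using assms ij unfolding S_edges_def by cases (auto simp: insert_commute)
qed

lemma singleton_notin_S_edges: "r < n \<Longrightarrow> {i} \<notin> S_edges n r"
  using simple_graph_S_edges[of r n] by (auto simp: simple_graph_def)

lemma sum_split_S: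
  fixes f :: "nat \<Rightarrow> real"
  assumes "r + 3 \<le> n"
  shows "(\<Sum>i<n. f i) = f 0 + (\<Sum>i=1..<n - r. f i) + (\<Sum>i=n - r..<n. f i)"
proof -
  have "(\<Sum>i<n. f i) = (\<Sum>i=0..<n - r. f i) + (\<Sum>i=n - r..<n. f i)"
    by (simp add: lessThan_atLeast0 sum.atLeastLessThan_concat)
  also have "(\<Sum>i=0..<n - r. f i) = f 0 + (\<Sum>i=1..<n - r. f i)"
    using assms by (simp add: sum.atLeast_Suc_lessThan)
  finally show ?thesis .
qed

text \<open>Adding \<open>u i\<close> to both sides of a noncentral clique row completes the clique
  sum, so the left side no longer depends on \<open>i\<close>; this is the source of the factor
  \<open>\<mu> + 1\<close>.\<close>

lemma eigenfun_S_iff: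
  assumes n: "r + 3 \<le> n"
  shows "eigenfun n (S_edges n r) \<mu> u \<longleftrightarrow> (\<exists>i<n. u i \<noteq> 0) \<and>
     (\<Sum>i=1..<n - r. u i) + (\<Sum>i=n - r..<n. u i) = \<mu> * u 0 \<and>
     (\<forall>i\<in>{1..<n - r}. u 0 + (\<Sum>j=1..<n - r. u j) = (\<mu> + 1) * u i) \<and>
     (\<forall>i\<in>{n - r..<n}. u 0 = \<mu> * u i)"
proof -
  let ?S = "\<lambda>i. \<Sum>j<n. if {i, j} \<in> S_edges n r then u j else 0"
  have centre: "?S 0 = (\<Sum>i=1..<n - r. u i) + (\<Sum>i=n - r..<n. u i)"
  proof -
    have "?S 0 = (\<Sum>j<n. if j = 0 then 0 else u j)"
      using n by (intro sum.cong refl) (auto simp: S_edges_iff singleton_notin_S_edges)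
    also have "\<dots> = (\<Sum>j=1..<n - r. if j = 0 then 0 else u j) +
        (\<Sum>j=n - r..<n. if j = 0 then 0 else u j)"
      using n by (simp add: sum_split_S)
    also have "\<dots> = (\<Sum>j=1..<n - r. u j) + (\<Sum>j=n - r..<n. u j)"
      using n by (intro arg_cong2[where f = "(+)"] sum.cong) auto
    finally show ?thesis .
  qed
  have clique: "?S i = u 0 + (\<Sum>j=1..<n - r. u j) - u i" if i: "i \<in> {1..<n - r}" for i
  proof -
    have "?S i = (\<Sum>j<n. (if j < n - r then u j else 0) - (if j = i then u j else 0))"
      using n i by (intro sum.cong refl) (auto simp: S_edges_iff singleton_notin_S_edges)
    also have "\<dots> = (\<Sum>j<n. if j < n - r then u j else 0) - u i"
      using i n by (auto simp: sum_subtractf)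
    finally show ?thesis using n by (simp add: sum_split_S)
  qed
  have pendent: "?S i = u 0" if i: "i \<in> {n - r..<n}" for i
  proof -
    have "?S i = (\<Sum>j<n. if j = 0 then u j else 0)"
      using n i by (intro sum.cong refl) (auto simp: S_edges_iff singleton_notin_S_edges)
    then show ?thesis using n by simp
  qed
  have "(\<forall>i<n. P i) \<longleftrightarrow> P 0 \<and> (\<forall>i\<in>{1..<n - r}. P i) \<and> (\<forall>i\<in>{n - r..<n}. P i)" for P
  proof -
    have "{..<n} = insert 0 ({1..<n - r} \<union> {n - r..<n})" using n by auto
    then show ?thesis by (metis (no_types, lifting) Un_iff insert_iff lessThan_iff)
  qed
  then have "(\<forall>i<n. ?S i = \<mu> * u i) \<longleftrightarrow> ?S 0 = \<mu> * u 0 \<and>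
      (\<forall>i\<in>{1..<n - r}. ?S i = \<mu> * u i) \<and> (\<forall>i\<in>{n - r..<n}. ?S i = \<mu> * u i)" .
  also have "\<dots> \<longleftrightarrow> (\<Sum>i=1..<n - r. u i) + (\<Sum>i=n - r..<n. u i) = \<mu> * u 0 \<and>
     (\<forall>i\<in>{1..<n - r}. u 0 + (\<Sum>j=1..<n - r. u j) = (\<mu> + 1) * u i) \<and>
     (\<forall>i\<in>{n - r..<n}. u 0 = \<mu> * u i)"
    by (auto simp: centre clique pendent algebra_simps)
  finally show ?thesis by (simp add: eigenfun_def)
qed

section \<open>Common roots of the cubic and the quadratic\<close>

text \<open>Completing the square leaves only \<open>k = 1\<close> when \<open>t\<close> is -1 or
  -2. The gap between 1 and 2 in the values of \<open>k\<close> matters: for \<open>t = -2\<close>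
  the quadratic has real roots up to \<open>k = 9 / 8\<close>. At \<open>x = 1\<close> the cubic
  equals -2 if \<open>k = 1\<close> or \<open>r = 2\<close>; at \<open>x = 2\<close> with
  \<open>k = 1\<close> it equals \<open>-r\<close>.\<close>

lemma no_common_root:
  fixes x k t :: real and r :: nat
  assumes k: "k = 1 \<or> k \<ge> 2" and r: "r \<ge> 1" and x: "x \<noteq> 0"
    and t: "t = -1 \<or> t = 0 \<and> r = 2 \<or> t = -2"
    and cubic: "x ^ 3 - k * x\<^sup>2 - (k + 1 + r) * x + r * k = 0"
    and quadratic: "x\<^sup>2 + (t - 1) * x - t * k = 0"
  shows False
  using t
proof (elim disjE conjE)
  assume t: "t = -1"
  have sq: "(x - 1)\<^sup>2 = 1 - k"
    using quadratic t by (simp add: power2_eq_square algebra_simps)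
  then have "k = 1" using k zero_le_power2[of "x - 1"] by linarith
  with sq have "x = 1" by simp
  with \<open>k = 1\<close> cubic show False by simp
next
  assume t: "t = 0" "r = 2"
  then have "x * (x - 1) = 0"
    using quadratic by (simp add: power2_eq_square algebra_simps)
  with x have "x = 1" by simp
  with cubic t show False by simp
next
  assume t: "t = -2"
  have sq: "(x - 3 / 2)\<^sup>2 = 9 / 4 - 2 * k"
    using quadratic t by (simp add: power2_eq_square algebra_simps)
  then have "k = 1" using k zero_le_power2[of "x - 3 / 2"] by linarith
  then have "(x - 1) * (x - 2) = 0"
    using quadratic t by (simp add: power2_eq_square algebra_simps)
  then have "x = 1 \<or> x = 2" by simp
  with \<open>k = 1\<close> cubic r show False by auto
qed

section \<open>Choice of the switching set and the cases for the eigenvalue\<close>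

theorem theorem3p1:
  fixes n r :: nat
  assumes "r \<ge> 1" and "n \<ge> r + 3"
  shows "\<exists>X \<subseteq> {0..<n}. \<forall>\<mu>::real.
           eigenvalue (adj_matrix n (S_edges n r) (switching n X)) \<mu> \<longrightarrow>
           main_eigenvalue n (S_edges n r) (switching n X) \<mu>"
proof -
  note n = \<open>n \<ge> r + 3\<close> and r = \<open>r \<ge> 1\<close>
  \<comment> \<open>The general formula would put both pendent vertices into \<open>X\<close> when
    \<open>r = 2\<close>, leaving no separated pair for the eigenvalue 0; hence the
    exception.\<close>
  define q where "q = (if r = 2 then 1 else r div 2 + 1)"
  define X where "X = insert 1 {n - r..<n - r + q}"
  \<comment> \<open>There are \<open>k + 1\<close> noncentral clique vertices, exactly one of them
    in \<open>X\<close>, so their signs add up to \<open>k - 1\<close>; \<open>t\<close> is the sum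
    of the pendent signs.\<close>
  define k t :: real where "k = real n - real r - 2" and "t = real r - 2 * real q"
  have q: "1 \<le> q" "q \<le> r" "r \<ge> 2 \<Longrightarrow> q < r" using r by (auto simp: q_def)
  have t: "t = -1 \<or> t = 0 \<and> r = 2 \<or> t = -2"
    by (cases "even r") (auto simp: t_def q_def elim!: evenE oddE)
  have k: "k = 1 \<or> k \<ge> 2"
  proof -
    have "k = real (n - r - 2)" "n - r - 2 = 1 \<or> n - r - 2 \<ge> 2" using n by (auto simp: k_def)
    then show ?thesis by (metis of_nat_1 of_nat_le_iff of_nat_numeral)
  qed
  have clique_signs: "(\<Sum>i=1..<n - r. switch_sign X i) = k - 1"
  proof -
    have "(\<Sum>i=1..<n - r. switch_sign X i) = switch_sign X 1 + (\<Sum>i=2..<n - r. switch_sign X i)"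
      using n by (simp add: sum.atLeast_Suc_lessThan numeral_2_eq_2)
    also have "(\<Sum>i=2..<n - r. switch_sign X i) = (\<Sum>i=2..<n - r. 1)"
      by (intro sum.cong refl) (auto simp: X_def switch_sign_def)
    finally show ?thesis using n by (simp add: X_def switch_sign_def k_def of_nat_diff)
  qed
  have pendent_signs: "(\<Sum>i=n - r..<n. switch_sign X i) = t"
  proof -
    have "(\<Sum>i=n - r..<n. switch_sign X i) =
      (\<Sum>i=n - r..<n - r + q. switch_sign X i) + (\<Sum>i=n - r + q..<n. switch_sign X i)"
      using n q by (intro sum.atLeastLessThan_concat[symmetric]) auto
    also have "(\<Sum>i=n - r..<n - r + q. switch_sign X i) = (\<Sum>i=n - r..<n - r + q. -1)"
      by (intro sum.cong refl) (auto simp: X_def switch_sign_def)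
    also have "(\<Sum>i=n - r + q..<n. switch_sign X i) = (\<Sum>i=n - r + q..<n. 1)"
      using n by (intro sum.cong refl) (auto simp: X_def switch_sign_def)
    finally show ?thesis using n q by (simp add: t_def of_nat_diff)
  qed
  have "main_eigenvalue n (S_edges n r) (switching n X) \<mu>"
    if ev: "eigenvalue (adj_matrix n (S_edges n r) (switching n X)) \<mu>" for \<mu>
  proof -
    obtain u where u: "eigenfun n (S_edges n r) \<mu> u"
      using ev by (rule eigenvalue_switchingD)
    define s where "s = (\<Sum>i=1..<n - r. u i)"
    have nz: "\<exists>i<n. u i \<noteq> 0"
      and centre: "s + (\<Sum>i=n - r..<n. u i) = \<mu> * u 0"
      and clique: "\<And>i. i \<in> {1..<n - r} \<Longrightarrow> u 0 + s = (\<mu> + 1) * u i"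
      and pendent: "\<And>i. i \<in> {n - r..<n} \<Longrightarrow> u 0 = \<mu> * u i"
      using u n by (simp_all add: eigenfun_S_iff s_def)
    consider "\<mu> = -1" | "\<mu> = 0" "r \<ge> 2" | "\<mu> = 0" "r = 1" | "\<mu> \<noteq> -1" "\<mu> \<noteq> 0"
      using r by linarith
    then show ?thesis
    proof cases
      case 1
      \<comment> \<open>Both 1 and 2 are noncentral clique vertices since
        \<open>n - r \<ge> 3\<close>, and only 1 lies in \<open>X\<close>, so the signed sum is
        -2.\<close>
      define w :: "nat \<Rightarrow> real" where "w i = (if i = 1 then 1 else 0) - (if i = 2 then 1 else 0)" for i
      have "eigenfun n (S_edges n r) \<mu> w"
        unfolding eigenfun_S_iff[OF n] using n 1
        by (auto simp: w_def sum_subtractf intro!: exI[of _ 1])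
      moreover have "(\<Sum>i<n. switch_sign X i * w i) \<noteq> 0"
        using n by (simp add: w_def right_diff_distrib sum_subtractf if_distrib[of "(*) _"]
            switch_sign_def X_def cong: if_cong)
      ultimately show ?thesis by (rule main_eigenvalue_switchingI)
    next
      case 2
      \<comment> \<open>The first pendent vertex lies in \<open>X\<close> by
        \<open>1 \<le> q\<close>, the last one does not by \<open>q < r\<close>.\<close>
      define w :: "nat \<Rightarrow> real"
        where "w i = (if i = n - r then 1 else 0) - (if i = n - 1 then 1 else 0)" for i
      have "eigenfun n (S_edges n r) \<mu> w"
        unfolding eigenfun_S_iff[OF n] using n 2
        by (auto simp: w_def sum_subtractf intro!: exI[of _ "n - r"])
      moreover have "switch_sign X (n - r) = -1" "switch_sign X (n - 1) = 1"
        using n 2 q by (auto simp: switch_sign_def X_def)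
      then have "(\<Sum>i<n. switch_sign X i * w i) \<noteq> 0"
        using n 2 by (simp add: w_def right_diff_distrib sum_subtractf if_distrib[of "(*) _"]
            cong: if_cong)
      ultimately show ?thesis by (rule main_eigenvalue_switchingI)
    next
      case 3
      \<comment> \<open>For \<open>r = 1\<close> the value 0 is not an eigenvalue: the equations
        force \<open>u\<close> to vanish at the centre, then on the clique, then at the pendent
        vertex.\<close>
      have u0: "u 0 = 0" using pendent[of "n - 1"] 3 n by simp
      have us: "u i = s" if "i \<in> {1..<n - r}" for i using clique[OF that] 3 u0 by simp
      then have "s = (k + 1) * s"
        using n unfolding s_def[symmetric] by (subst (1) s_def) (simp add: k_def of_nat_diff)
      then have "s = 0" using k by auto
      moreover have "u (n - 1) = 0"
      proof -
        have "{n - r..<n} = {n - 1}" using 3 n by auto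
        then show ?thesis using centre \<open>s = 0\<close> u0 by simp
      qed
      ultimately have "u i = 0" if "i < n" for i
        using that us[of i] u0 3 by (cases "i = 0 \<or> i = n - 1") auto
      with nz show ?thesis by blast
    next
      case 4
      define a y where "a = u 1" and "y = u (n - 1)"
      have ua: "u i = a" if "i \<in> {1..<n - r}" for i
        using clique[OF that] clique[of 1] n 4 by (simp add: a_def)
      have uy: "u i = y" if "i \<in> {n - r..<n}" for i
        using pendent[OF that] pendent[of "n - 1"] n r 4 by (simp add: y_def)
      have s: "s = (k + 1) * a" using n ua by (simp add: s_def k_def of_nat_diff)
      have sy: "(\<Sum>i=n - r..<n. u i) = r * y" using n uy by simp
      have eqs: "(\<mu> - k) * a = u 0" "\<mu> * y = u 0" "(k + 1) * a + r * y = \<mu> * u 0"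
        using clique[of 1] pendent[of "n - 1"] centre n r s sy
        by (auto simp: a_def y_def algebra_simps)
      \<comment> \<open>This allows \<open>u 0\<close> to be cancelled from both polynomial
        identities below.\<close>
      have u0: "u 0 \<noteq> 0"
      proof
        assume 0: "u 0 = 0"
        then have "y = 0" using eqs 4 by simp
        then have "a = 0" using eqs 0 k by auto
        have "u i = 0" if "i < n" for i
          using that 0 \<open>y = 0\<close> \<open>a = 0\<close> ua[of i] uy[of i] by (cases "i = 0"; cases "i < n - r") auto
        with nz show False by blast
      qed
      have cubic: "\<mu> ^ 3 - k * \<mu>\<^sup>2 - (k + 1 + r) * \<mu> + r * k = 0"
      proof -
        \<comment> \<open>Multiplying the centre equation by \<open>\<mu> * (\<mu> - k)\<close>
          eliminates \<open>a\<close> and \<open>y\<close> without dividing.\<close>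
        have "(\<mu> ^ 3 - k * \<mu>\<^sup>2 - (k + 1 + r) * \<mu> + r * k) * u 0 =
          \<mu> * (\<mu> - k) * (\<mu> * u 0) - (k + 1) * \<mu> * u 0 - r * (\<mu> - k) * u 0"
          by (simp add: algebra_simps power2_eq_square power3_eq_cube)
        also have "\<dots> = \<mu> * (\<mu> - k) * ((k + 1) * a + r * y) - (k + 1) * \<mu> * ((\<mu> - k) * a)
            - r * (\<mu> - k) * (\<mu> * y)"
          by (simp only: eqs)
        also have "\<dots> = 0" by (simp add: algebra_simps)
        finally show ?thesis using u0 by simp
      qed
      have "(\<Sum>i<n. switch_sign X i * u i) \<noteq> 0"
      proof
        assume "(\<Sum>i<n. switch_sign X i * u i) = 0"
        moreover have "(\<Sum>i<n. switch_sign X i * u i) = u 0 + (k - 1) * a + t * y"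
        proof -
          have "(\<Sum>i=1..<n - r. switch_sign X i * u i) = (k - 1) * a"
            using ua by (simp flip: clique_signs add: sum_distrib_right)
          moreover have "(\<Sum>i=n - r..<n. switch_sign X i * u i) = t * y"
            using uy by (simp flip: pendent_signs add: sum_distrib_right)
          moreover have "switch_sign X 0 = 1" using n by (simp add: switch_sign_def X_def)
          ultimately show ?thesis using n by (simp add: sum_split_S)
        qed
        ultimately have sum0: "u 0 + (k - 1) * a + t * y = 0" by simp
        \<comment> \<open>The same multiplier eliminates \<open>a\<close> and \<open>y\<close> from
          the signed sum.\<close>
        have "(\<mu>\<^sup>2 + (t - 1) * \<mu> - t * k) * u 0 =
          \<mu> * (\<mu> - k) * u 0 + (k - 1) * \<mu> * u 0 + t * (\<mu> - k) * u 0"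
          by (simp add: algebra_simps power2_eq_square)
        also have "\<dots> = \<mu> * (\<mu> - k) * u 0 + (k - 1) * \<mu> * ((\<mu> - k) * a)
            + t * (\<mu> - k) * (\<mu> * y)"
          by (simp only: eqs)
        also have "\<dots> = \<mu> * (\<mu> - k) * (u 0 + (k - 1) * a + t * y)" by (simp add: algebra_simps)
        finally have "\<mu>\<^sup>2 + (t - 1) * \<mu> - t * k = 0" using u0 sum0 by simp
        with no_common_root[OF k r] t cubic 4 show False by blast
      qed
      with u show ?thesis by (rule main_eigenvalue_switchingI)
    qed
  qed
  moreover have "X \<subseteq> {0..<n}" using n q by (auto simp: X_def)
  ultimately show ?thesis by blast
qed

end
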